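(* Let $(M,J,g)$ be a metallic-like pseudo-Riemannian manifold with associated tensor field $J^{\ast}$, let $\nabla$ be a linear connection on $M$ and let $\nabla^{\ast}$ be its $g$-conjugate connection. 1) If both $(\nabla,J^{\ast})$ and $(\nabla^{\ast},J)$ are Codazzi-coupled, then $\nabla J^{\ast}=\nabla^{\ast}J$. 2) If both $(\nabla^{\ast},J^{\ast})$ and $(\nabla,J)$ are Codazzi-coupled, then $\nabla^{\ast}J^{\ast}=\nabla J$.
   Context: A metallic structure on a smooth manifold $M$ is a $(1,1)$-tensor field $J$, which is a bundle isomorphism $TM\to TM$, such that $J^2=pJ+qI$ for some real numbers $p,q$ ($I$ the identity). A metallic-like pseudo-Riemannian manifold $(M,J,g)$ is a pseudo-Riemannian manifold $(M,g)$ with a metallic structure $J$ (not assumed $g$-symmetric) together with the $(1,1)$-tensor field $J^{\ast}$ satisfying $g(JX,Y)=g(X,J^{\ast}Y)$ for all vector fields $X,Y$ (so $(J^{\ast})^{\ast}=J$). For a linear connection $D$ and a $(1,1)$-tensor field $K$, the pair $(D,K)$ is Codazzi-coupled if $(D_XK)Y=(D_YK)X$ for all vector fields $X,Y$. The $g$-conjugate connection $\nabla^{\ast}$ of $\nabla$ is defined by $Zg(X,Y)=g(\nabla_ZX,Y)+g(X,\nabla^{\ast}_ZY)$ for all vector fields $X,Y,Z$. *)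

theory Defs
  imports "HOL-Analysis.Analysis" "HOL-Library.Function_Algebras"
begin

instantiation "fun" :: (type, real_vector) real_vector
begin

definition "a *\<^sub>R f = (\<lambda>x. a *\<^sub>R f x)"

instance
  by standard (simp_all add: scaleR_fun_def fun_eq_iff scaleR_add_right scaleR_add_left)

end

lemma scaleR_fun_apply [simp]: "(a *\<^sub>R f) x = a *\<^sub>R f x"
  by (simp add: scaleR_fun_def)


text \<open>The set \<open>S\<close> is meant to be open: derivatives are taken in the ambient space.\<close>

primrec Ck_on :: "nat \<Rightarrow> 'a::real_normed_vector set \<Rightarrow> ('a \<Rightarrow> 'b::real_normed_vector) \<Rightarrow> bool" where
  "Ck_on 0 S f \<longleftrightarrow> continuous_on S f"
| "Ck_on (Suc k) S f \<longleftrightarrow>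
     (\<forall>x\<in>S. f differentiable (at x)) \<and>
     (\<forall>v. Ck_on k S (\<lambda>x. frechet_derivative f (at x) v))"

definition smooth_on :: "'a::real_normed_vector set \<Rightarrow> ('a \<Rightarrow> 'b::real_normed_vector) \<Rightarrow> bool" where
  "smooth_on S f \<longleftrightarrow> (\<forall>k. Ck_on k S f)"


text \<open>
  A chart is a pair of its domain \<open>U\<close> and its coordinate map; the values of the coordinate map
  outside \<open>U\<close> are irrelevant. A smooth structure is given by any smooth atlas, which need not
  be maximal.
\<close>

type_synonym ('m, 'e) chart = "'m set \<times> ('m \<Rightarrow> 'e)"

definition chart_inv :: "('m, 'e) chart \<Rightarrow> 'e \<Rightarrow> 'm" where
  "chart_inv c = inv_into (fst c) (snd c)"

definition transition :: "('m, 'e) chart \<Rightarrow> ('m, 'e) chart \<Rightarrow> 'e \<Rightarrow> 'e" where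
  "transition c d = snd d \<circ> chart_inv c"

definition smooth_manifold :: "'m topology \<Rightarrow> ('m, 'e::euclidean_space) chart set \<Rightarrow> bool" where
  "smooth_manifold M A \<longleftrightarrow>
     Hausdorff_space M \<and> second_countable M \<and>
     (\<forall>(U, \<phi>)\<in>A. openin M U \<and> open (\<phi> ` U) \<and>
        homeomorphic_map (subtopology M U) (top_of_set (\<phi> ` U)) \<phi>) \<and>
     (\<Union>c\<in>A. fst c) = topspace M \<and>
     (\<forall>c\<in>A. \<forall>d\<in>A. smooth_on (snd c ` (fst c \<inter> fst d)) (transition c d))"

definition charts_at :: "('m, 'e) chart set \<Rightarrow> 'm \<Rightarrow> ('m, 'e) chart set" where
  "charts_at A p = {c \<in> A. p \<in> fst c}"

definition smooth_fun ::
    "('m, 'e::euclidean_space) chart set \<Rightarrow> ('m \<Rightarrow> real) \<Rightarrow> bool" where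
  "smooth_fun A f \<longleftrightarrow> (\<forall>c\<in>A. smooth_on (snd c ` fst c) (f \<circ> chart_inv c))"


text \<open>
  A tangent vector at \<open>p\<close> is the family of its coordinate vectors with respect to the charts
  around \<open>p\<close>, subject to the transformation law given by the differentials of the transition
  maps; it is extended by \<open>0\<close> to the other charts. The vector space operations are those
  of the function space. If no chart contains \<open>p\<close>, then the tangent space is \<open>{0}\<close>, so the
  conditions below need no restriction to points of the manifold.
\<close>

type_synonym ('m, 'e) tangent = "('m, 'e) chart \<Rightarrow> 'e"

definition tangent_space ::
    "('m, 'e::euclidean_space) chart set \<Rightarrow> 'm \<Rightarrow> ('m, 'e) tangent set" where
  "tangent_space A p =
     {v. (\<forall>c. c \<notin> charts_at A p \<longrightarrow> v c = 0) \<and>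
         (\<forall>c\<in>charts_at A p. \<forall>d\<in>charts_at A p.
            v d = frechet_derivative (transition c d) (at (snd c p)) (v c))}"

text \<open>The tangent vector at \<open>p\<close> whose coordinate vector in the chart \<open>c\<close> is \<open>e\<close>; for \<open>e\<close> a
  basis vector this is the coordinate vector field of \<open>c\<close> at \<open>p\<close>.\<close>

definition coord_vector ::
    "('m, 'e::euclidean_space) chart set \<Rightarrow> ('m, 'e) chart \<Rightarrow> 'm \<Rightarrow> 'e \<Rightarrow> ('m, 'e) tangent" where
  "coord_vector A c p e =
     (\<lambda>d. if d \<in> charts_at A p
          then frechet_derivative (transition c d) (at (snd c p)) e else 0)"

type_synonym ('m, 'e) field = "'m \<Rightarrow> ('m, 'e) tangent"

definition vector_fields ::
    "('m, 'e::euclidean_space) chart set \<Rightarrow> ('m, 'e) field set" where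
  "vector_fields A =
     {X. (\<forall>p. X p \<in> tangent_space A p) \<and>
         (\<forall>c\<in>A. smooth_on (snd c ` fst c) (\<lambda>x. X (chart_inv c x) c))}"

definition field_scale :: "('m \<Rightarrow> real) \<Rightarrow> ('m, 'e::euclidean_space) field \<Rightarrow> ('m, 'e) field" where
  "field_scale f X = (\<lambda>p. f p *\<^sub>R X p)"

text \<open>The function \<open>Xf\<close>. For differentiable \<open>f\<close> and \<open>p\<close> in the manifold, the value does not
  depend on the choice of the chart, by the chain rule.\<close>

definition field_deriv ::
    "('m, 'e::euclidean_space) chart set \<Rightarrow> ('m, 'e) field \<Rightarrow> ('m \<Rightarrow> real) \<Rightarrow> 'm \<Rightarrow> real" where
  "field_deriv A X f p =
     (let c = (SOME c. c \<in> charts_at A p)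
      in frechet_derivative (f \<circ> chart_inv c) (at (snd c p)) (X p c))"


type_synonym ('m, 'e) endo = "'m \<Rightarrow> ('m, 'e) tangent \<Rightarrow> ('m, 'e) tangent"

text \<open>Smoothness of a tensor field is smoothness of its components in every chart.\<close>

definition tensor_field11 ::
    "('m, 'e::euclidean_space) chart set \<Rightarrow> ('m, 'e) endo \<Rightarrow> bool" where
  "tensor_field11 A K \<longleftrightarrow>
     (\<forall>p. \<forall>u\<in>tangent_space A p. K p u \<in> tangent_space A p \<and>
        (\<forall>a. K p (a *\<^sub>R u) = a *\<^sub>R K p u) \<and>
        (\<forall>v\<in>tangent_space A p. K p (u + v) = K p u + K p v)) \<and>
     (\<forall>c\<in>A. \<forall>e. smooth_on (snd c ` fst c)
        (\<lambda>x. K (chart_inv c x) (coord_vector A c (chart_inv c x) e) c))"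

definition endo_apply :: "('m, 'e) endo \<Rightarrow> ('m, 'e) field \<Rightarrow> ('m, 'e) field" where
  "endo_apply K X = (\<lambda>p. K p (X p))"

type_synonym ('m, 'e) form2 = "'m \<Rightarrow> ('m, 'e) tangent \<Rightarrow> ('m, 'e) tangent \<Rightarrow> real"

definition form_apply :: "('m, 'e) form2 \<Rightarrow> ('m, 'e) field \<Rightarrow> ('m, 'e) field \<Rightarrow> 'm \<Rightarrow> real" where
  "form_apply g X Y = (\<lambda>p. g p (X p) (Y p))"

text \<open>Linearity in the second argument follows from symmetry.\<close>

definition pseudo_Riemannian_metric ::
    "('m, 'e::euclidean_space) chart set \<Rightarrow> ('m, 'e) form2 \<Rightarrow> bool" where
  "pseudo_Riemannian_metric A g \<longleftrightarrow>
     (\<forall>p. \<forall>u\<in>tangent_space A p. \<forall>v\<in>tangent_space A p.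
        g p u v = g p v u \<and>
        (\<forall>a. g p (a *\<^sub>R u) v = a * g p u v) \<and>
        (\<forall>w\<in>tangent_space A p. g p (u + w) v = g p u v + g p w v)) \<and>
     (\<forall>p. \<forall>u\<in>tangent_space A p. (\<forall>v\<in>tangent_space A p. g p u v = 0) \<longrightarrow> u = 0) \<and>
     (\<forall>c\<in>A. \<forall>e e'. smooth_on (snd c ` fst c)
        (\<lambda>x. g (chart_inv c x) (coord_vector A c (chart_inv c x) e)
                               (coord_vector A c (chart_inv c x) e')))"

definition metallic_structure ::
    "('m, 'e::euclidean_space) chart set \<Rightarrow> ('m, 'e) endo \<Rightarrow> bool" where
  "metallic_structure A J \<longleftrightarrow>
     tensor_field11 A J \<and>
     (\<forall>x. bij_betw (J x) (tangent_space A x) (tangent_space A x)) \<and>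
     (\<exists>p q :: real. \<forall>x. \<forall>v\<in>tangent_space A x. J x (J x v) = p *\<^sub>R J x v + q *\<^sub>R v)"

definition metallic_like_pseudo_Riemannian ::
    "'m topology \<Rightarrow> ('m, 'e::euclidean_space) chart set \<Rightarrow>
     ('m, 'e) endo \<Rightarrow> ('m, 'e) form2 \<Rightarrow> ('m, 'e) endo \<Rightarrow> bool" where
  "metallic_like_pseudo_Riemannian M A J g Js \<longleftrightarrow>
     smooth_manifold M A \<and> pseudo_Riemannian_metric A g \<and> metallic_structure A J \<and>
     tensor_field11 A Js \<and>
     (\<forall>X\<in>vector_fields A. \<forall>Y\<in>vector_fields A.
        form_apply g (endo_apply J X) Y = form_apply g X (endo_apply Js Y))"


text \<open>A connection is written as \<open>D X Y\<close> for the covariant derivative of \<open>Y\<close> in direction \<open>X\<close>;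
  only its values on smooth vector fields matter.\<close>

type_synonym ('m, 'e) connection = "('m, 'e) field \<Rightarrow> ('m, 'e) field \<Rightarrow> ('m, 'e) field"

definition linear_connection ::
    "('m, 'e::euclidean_space) chart set \<Rightarrow> ('m, 'e) connection \<Rightarrow> bool" where
  "linear_connection A D \<longleftrightarrow>
     (\<forall>X\<in>vector_fields A. \<forall>Y\<in>vector_fields A.
        D X Y \<in> vector_fields A \<and>
        (\<forall>Z\<in>vector_fields A. D (X + Z) Y = D X Y + D Z Y \<and> D X (Y + Z) = D X Y + D X Z) \<and>
        (\<forall>f. smooth_fun A f \<longrightarrow>
           D (field_scale f X) Y = field_scale f (D X Y) \<and>
           D X (field_scale f Y) = field_scale (field_deriv A X f) Y + field_scale f (D X Y)))"

text \<open>The covariant derivative \<open>(D\<^sub>X K) Y\<close> of a (1,1)-tensor field \<open>K\<close>.\<close>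

definition cov_deriv ::
    "('m, 'e::euclidean_space) connection \<Rightarrow> ('m, 'e) endo \<Rightarrow> ('m, 'e) connection" where
  "cov_deriv D K X Y = D X (endo_apply K Y) - endo_apply K (D X Y)"

definition Codazzi_coupled ::
    "('m, 'e::euclidean_space) chart set \<Rightarrow> ('m, 'e) connection \<Rightarrow> ('m, 'e) endo \<Rightarrow> bool" where
  "Codazzi_coupled A D K \<longleftrightarrow>
     (\<forall>X\<in>vector_fields A. \<forall>Y\<in>vector_fields A. cov_deriv D K X Y = cov_deriv D K Y X)"

definition conjugate_connection ::
    "'m topology \<Rightarrow> ('m, 'e::euclidean_space) chart set \<Rightarrow> ('m, 'e) form2 \<Rightarrow>
     ('m, 'e) connection \<Rightarrow> ('m, 'e) connection \<Rightarrow> bool" where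
  "conjugate_connection M A g D Ds \<longleftrightarrow>
     linear_connection A Ds \<and>
     (\<forall>X\<in>vector_fields A. \<forall>Y\<in>vector_fields A. \<forall>Z\<in>vector_fields A. \<forall>p\<in>topspace M.
        field_deriv A Z (form_apply g X Y) p =
        form_apply g (D Z X) Y p + form_apply g X (Ds Z Y) p)"

text \<open>Equality of \<open>D K\<close> and \<open>D' K'\<close> as (1,2)-tensor fields.\<close>

definition cov_deriv_eq ::
    "('m, 'e::euclidean_space) chart set \<Rightarrow> ('m, 'e) connection \<Rightarrow> ('m, 'e) endo \<Rightarrow>
     ('m, 'e) connection \<Rightarrow> ('m, 'e) endo \<Rightarrow> bool" where
  "cov_deriv_eq A D K D' K' \<longleftrightarrow>
     (\<forall>X\<in>vector_fields A. \<forall>Y\<in>vector_fields A. cov_deriv D K X Y = cov_deriv D' K' X Y)"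

end

theory Submission
  imports Defs
begin

text \<open>
  Differentiating \<open>g(J\<^sup>*Y, Z) = g(Y, JZ)\<close> along \<open>X\<close> and expanding both sides with
  the product rule of the conjugate pair \<open>(D, D\<^sup>*)\<close> shows that covariant differentiation
  is compatible with passing to the adjoint: for \<open>T = DJ\<^sup>*\<close> and \<open>S = D\<^sup>*J\<close>,
  \<open>g(T(X,Y), Z) = g(S(X,Z), Y)\<close> (\<open>adjoint_cov_deriv\<close>). Being Codazzi-coupled means that
  \<open>T\<close> and \<open>S\<close> are symmetric in their two arguments. Alternating these two rules
  permutes the arguments until \<open>T\<close> has become \<open>S\<close>:
  \<open>g(T(X,Y),Z) = g(S(X,Z),Y) = g(S(Z,X),Y) = g(T(Z,Y),X) = g(T(Y,Z),X) = g(S(Y,X),Z) = g(S(X,Y),Z)\<close>,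
  and nondegeneracy of \<open>g\<close> gives \<open>T = S\<close>. Since conjugation of connections is symmetric,
  the second claim is the first one for the pair \<open>(D\<^sup>*, D)\<close>.

  Two points of this argument are analytic. The product rule is applied to the fields \<open>JZ\<close> and
  \<open>J\<^sup>*Y\<close>, so a smooth tensor field must map smooth fields to smooth fields
  (\<open>endo_apply_vector_field\<close>). And \<open>g\<close> is nondegenerate on tangent vectors, whereas the
  identity above is about global smooth fields \<open>Z\<close>; hence every tangent vector must be, up to a
  nonzero factor, the value of such a field (\<open>cutoff_field_extends_tangent\<close>). This field is a
  coordinate field multiplied by a bump function.
\<close>

section \<open>Calculus of iterated differentiability\<close>

lemma Ck_on_subset: "Ck_on k T f \<Longrightarrow> S \<subseteq> T \<Longrightarrow> Ck_on k S f"
  by (induction k arbitrary: f) (auto intro: continuous_on_subset)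

lemma frechet_derivative_cong_open:
  assumes "open S" "x \<in> S" "\<And>y. y \<in> S \<Longrightarrow> f y = g y"
  shows "frechet_derivative f (at x) = frechet_derivative g (at x)"
proof -
  have "(f has_derivative D) (at x) \<longleftrightarrow> (g has_derivative D) (at x)" for D
    using assms has_derivative_transform_within_open[of f D x UNIV S g]
      has_derivative_transform_within_open[of g D x UNIV S f] by auto
  then show ?thesis by (simp add: frechet_derivative_def)
qed

lemma Ck_on_cong:
  assumes "open S" "\<And>x. x \<in> S \<Longrightarrow> f x = g x" "Ck_on k S f"
  shows "Ck_on k S g"
  using assms(2,3)
proof (induction k arbitrary: f g)
  case 0
  then show ?case by (simp cong: continuous_on_cong)
next
  case (Suc k)
  have "g differentiable (at x)" if "x \<in> S" for x
    using Suc.prems that \<open>open S\<close> has_derivative_transform_within_open[of f _ x UNIV S g]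
    unfolding differentiable_def Ck_on.simps by blast
  moreover have "Ck_on k S (\<lambda>x. frechet_derivative g (at x) v)" for v
  proof (rule Suc.IH)
    show "Ck_on k S (\<lambda>x. frechet_derivative f (at x) v)" using Suc.prems by simp
    show "frechet_derivative f (at x) v = frechet_derivative g (at x) v" if "x \<in> S" for x
      using frechet_derivative_cong_open[OF \<open>open S\<close> that] Suc.prems(1) by metis
  qed
  ultimately show ?case by simp
qed

lemma Ck_on_Un:
  assumes "open S" "open T" "Ck_on k S f" "Ck_on k T f"
  shows "Ck_on k (S \<union> T) f"
  using assms(3,4)
proof (induction k arbitrary: f)
  case 0
  then show ?case using continuous_on_open_Un[OF assms(1,2)] by simp
qed auto

lemma Ck_on_Suc_imp: "Ck_on (Suc k) S f \<Longrightarrow> Ck_on k S f"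
proof (induction k arbitrary: f)
  case 0
  then have "isCont f x" if "x \<in> S" for x
    using that by (simp add: differentiable_imp_continuous_within)
  then show ?case by (simp add: continuous_at_imp_continuous_on)
next
  case (Suc k)
  have "Ck_on (Suc k) S (\<lambda>x. frechet_derivative f (at x) v)" for v
    using Suc.prems by (subst (asm) Ck_on.simps(2)) blast
  then have "Ck_on k S (\<lambda>x. frechet_derivative f (at x) v)" for v
    by (rule Suc.IH)
  moreover have "f differentiable (at x)" if "x \<in> S" for x
    using Suc.prems that by (subst (asm) Ck_on.simps(2)) blast
  ultimately show ?case by simp
qed

text \<open>An induction step on \<open>k\<close> for a combination of functions only needs an explicit formula for its
  derivative, whose components are combinations of the same kind.\<close>

lemma Ck_on_SucI:
  assumes "open S" "\<And>x. x \<in> S \<Longrightarrow> (f has_derivative f' x) (at x)"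
    "\<And>v. Ck_on k S (\<lambda>x. f' x v)"
  shows "Ck_on (Suc k) S f"
proof -
  have "f' x = frechet_derivative f (at x)" if "x \<in> S" for x
    by (rule frechet_derivative_at[OF assms(2)[OF that]])
  then have "Ck_on k S (\<lambda>x. frechet_derivative f (at x) v)" for v
    by (intro Ck_on_cong[OF assms(1) _ assms(3)]) simp
  moreover have "f differentiable (at x)" if "x \<in> S" for x
    using assms(2)[OF that] by (rule differentiableI)
  ultimately show ?thesis by simp
qed

lemma Ck_on_SucD:
  assumes "Ck_on (Suc k) S f" "x \<in> S"
  shows "(f has_derivative frechet_derivative f (at x)) (at x)"
proof -
  have "f differentiable (at x)" using assms by simp
  then show ?thesis by (simp only: frechet_derivative_works)
qed

lemma Ck_on_const:
  assumes "open S"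
  shows "Ck_on k S (\<lambda>x. c)"
proof (induction k arbitrary: c)
  case 0
  show ?case by simp
next
  case (Suc k)
  show ?case by (rule Ck_on_SucI[OF assms has_derivative_const Suc])
qed

lemma Ck_on_bounded_linear:
  assumes "bounded_linear L" "open S"
  shows "Ck_on k S L"
proof (cases k)
  case 0
  then show ?thesis using linear_continuous_on[OF assms(1)] by simp
next
  case (Suc n)
  show ?thesis
    unfolding Suc
    by (rule Ck_on_SucI[OF assms(2) bounded_linear_imp_has_derivative[OF assms(1)]
          Ck_on_const[OF assms(2)]])
qed

lemma Ck_on_add:
  assumes "open S" "Ck_on k S f" "Ck_on k S g"
  shows "Ck_on k S (\<lambda>x. f x + g x)"
  using assms(2,3)
proof (induction k arbitrary: f g)
  case 0
  then show ?case by (simp add: continuous_on_add)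
next
  case (Suc k)
  show ?case
    by (rule Ck_on_SucI[OF assms(1) has_derivative_add[OF Ck_on_SucD Ck_on_SucD]])
       (use Suc in auto)
qed

lemma Ck_on_sum:
  assumes "open S" "\<And>i. i \<in> I \<Longrightarrow> Ck_on k S (f i)"
  shows "Ck_on k S (\<lambda>x. \<Sum>i\<in>I. f i x)"
  using assms(2)
  by (induction I rule: infinite_finite_induct) (auto intro: Ck_on_const Ck_on_add assms(1))

lemma Ck_on_bilinear:
  fixes prod :: "'b::real_normed_vector \<Rightarrow> 'c::real_normed_vector \<Rightarrow> 'd::real_normed_vector"
  assumes bil: "bounded_bilinear prod" and "open S" "Ck_on k S f" "Ck_on k S g"
  shows "Ck_on k S (\<lambda>x. prod (f x) (g x))"
  using assms(3,4)
proof (induction k arbitrary: f g)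
  case 0
  then show ?case using bounded_bilinear.continuous_on[OF bil] by simp
next
  case (Suc k)
  show ?case
  proof (rule Ck_on_SucI[OF \<open>open S\<close> bounded_bilinear.FDERIV[OF bil Ck_on_SucD Ck_on_SucD]])
    show "Ck_on k S (\<lambda>x. prod (f x) (frechet_derivative g (at x) v)
                       + prod (frechet_derivative f (at x) v) (g x))" for v
      using Suc.prems Ck_on_Suc_imp[OF Suc.prems(1)] Ck_on_Suc_imp[OF Suc.prems(2)]
      by (intro Ck_on_add Suc.IH \<open>open S\<close>) auto
  qed (use Suc.prems in auto)
qed

lemma linear_expand_Basis:
  fixes L :: "'a::euclidean_space \<Rightarrow> 'b::real_vector"
  assumes "linear L"
  shows "L x = (\<Sum>b\<in>Basis. (x \<bullet> b) *\<^sub>R L b)"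
proof -
  have "L x = L (\<Sum>b\<in>Basis. (x \<bullet> b) *\<^sub>R b)" by (simp add: euclidean_representation)
  then show ?thesis using assms by (simp add: linear_sum linear_scale)
qed

lemma Ck_on_linear_comp:
  assumes "bounded_linear L" "open S" "Ck_on k S f"
  shows "Ck_on k S (\<lambda>x. L (f x))"
  using assms(3)
proof (induction k arbitrary: f)
  case 0
  then show ?case using bounded_linear.continuous_on[OF assms(1)] by simp
next
  case (Suc k)
  show ?case
    by (rule Ck_on_SucI[OF assms(2) bounded_linear.has_derivative[OF assms(1) Ck_on_SucD]])
       (use Suc in auto)
qed

text \<open>The chain rule writes a directional derivative of the composition as
  \<open>\<Sum>b. (H x v \<bullet> b) *\<^sub>R F x b\<close> over an orthonormal basis. Only for fixed \<open>b\<close> is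
  \<open>F x b\<close> a directional derivative of \<open>f\<close> composed with \<open>h\<close>, to which the induction
  hypothesis applies; this is why the domain of \<open>f\<close> is Euclidean.\<close>

lemma Ck_on_compose:
  fixes f :: "'b::euclidean_space \<Rightarrow> 'c::real_normed_vector"
    and h :: "'a::real_normed_vector \<Rightarrow> 'b"
  assumes "open S" "open T" "h ` S \<subseteq> T" "Ck_on k S h" "Ck_on k T f"
  shows "Ck_on k S (\<lambda>x. f (h x))"
  using assms(4,5)
proof (induction k arbitrary: f)
  case 0
  then show ?case using continuous_on_compose2[of T f S h] assms(3) by auto
next
  case (Suc k)
  define F where "F x = frechet_derivative f (at (h x))" for x
  define H where "H x = frechet_derivative h (at x)" for x
  have F: "(f has_derivative F x) (at (h x))" if "x \<in> S" for x
    using Ck_on_SucD[OF Suc.prems(2)] that assms(3) by (auto simp: F_def)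
  have H: "(h has_derivative H x) (at x)" if "x \<in> S" for x
    using Ck_on_SucD[OF Suc.prems(1) that] by (simp add: H_def)
  show ?case
  proof (rule Ck_on_SucI[OF assms(1)])
    show "((\<lambda>x. f (h x)) has_derivative (\<lambda>v. F x (H x v))) (at x)" if "x \<in> S" for x
      using has_derivative_compose[OF H F] that by simp
    show "Ck_on k S (\<lambda>x. F x (H x v))" for v
    proof (rule Ck_on_cong[OF assms(1)])
      show "(\<Sum>b\<in>Basis. (H x v \<bullet> b) *\<^sub>R F x b) = F x (H x v)" if "x \<in> S" for x
        using linear_expand_Basis[OF has_derivative_linear[OF F[OF that]]] by metis
      show "Ck_on k S (\<lambda>x. \<Sum>b\<in>Basis. (H x v \<bullet> b) *\<^sub>R F x b)"
      proof (intro Ck_on_sum Ck_on_bilinear[OF bounded_bilinear_scaleR] assms(1))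
        show "Ck_on k S (\<lambda>x. H x v \<bullet> b)" for b :: 'b
          unfolding H_def
          by (rule Ck_on_linear_comp[OF bounded_linear_inner_left assms(1)])
             (use Suc.prems(1) in simp)
        show "Ck_on k S (\<lambda>x. F x b)" for b
          unfolding F_def using Suc.prems
          by (intro Suc.IH[OF Ck_on_Suc_imp]) auto
      qed
    qed
  qed
qed

section \<open>A smooth bump function\<close>

text \<open>The classical flat function is the case \<open>n = 0\<close>; the denominators make the family closed under
  differentiation up to linear combinations.\<close>

definition exp_recip :: "nat \<Rightarrow> real \<Rightarrow> real" where
  "exp_recip n t = (if t \<le> 0 then 0 else exp (- (1 / t)) / t ^ n)"

text \<open>Comparing \<open>exp (1 / t)\<close> with the single term of index \<open>n + 2\<close> of its power series bounds
  the function by a multiple of \<open>t\<^sup>2\<close>, which yields the derivative \<open>0\<close> at the origin.\<close>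

lemma exp_recip_bound: "\<bar>exp_recip n t\<bar> \<le> fact (n + 2) * t\<^sup>2"
proof (cases "t \<le> 0")
  case False
  then have t: "t > 0" by simp
  have "(1 / t) ^ (n + 2) / fact (n + 2) \<le> exp (1 / t)"
  proof -
    have "(\<Sum>i\<in>{n+2}. (1 / t) ^ i /\<^sub>R fact i) \<le> (\<Sum>i. (1 / t) ^ i /\<^sub>R fact i)"
      by (rule sum_le_suminf[OF summable_exp_generic]) (use t in auto)
    also have "\<dots> = exp (1 / t)" by (simp only: exp_def)
    finally show ?thesis by (simp add: divide_inverse mult_ac)
  qed
  moreover have "1 / E \<le> a * P" if "1 / P / a \<le> E" "a > 0" "P > 0" "E > 0" for a P E :: real
    using that by (simp add: field_simps)
  ultimately have "1 / exp (1 / t) \<le> fact (n + 2) * t ^ (n + 2)"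
    using t by (metis exp_gt_zero fact_gt_zero power_one_over zero_less_power)
  then have "exp (- (1 / t)) \<le> fact (n + 2) * t ^ (n + 2)"
    by (simp only: exp_minus inverse_eq_divide)
  then show ?thesis using False by (simp add: exp_recip_def field_simps power_add power2_eq_square)
qed (simp add: exp_recip_def)

lemma exp_recip_has_derivative:
  "(exp_recip n has_real_derivative (exp_recip (n + 2) t - real n * exp_recip (n + 1) t)) (at t)"
proof -
  \<comment> \<open>The flatness at the origin is the only case not covered by differentiation rules.\<close>
  consider "t < 0" | "t = 0" | "t > 0" by linarith
  then show ?thesis
  proof cases
    case 1
    have "(exp_recip n has_real_derivative 0) (at t)"
      by (rule has_field_derivative_transform_within_open[where f = "\<lambda>_. 0" and S = "{..<0}"])
         (use 1 in \<open>auto simp: exp_recip_def\<close>)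
    then show ?thesis using 1 by (simp add: exp_recip_def)
  next
    case 2
    have "((\<lambda>h. (exp_recip n (0 + h) - exp_recip n 0) / h) \<longlongrightarrow> 0) (at 0)"
    proof (rule Lim_null_comparison)
      show "\<forall>\<^sub>F h in at 0. norm ((exp_recip n (0 + h) - exp_recip n 0) / h) \<le> fact (n + 2) * \<bar>h\<bar>"
      proof (rule always_eventually, rule allI)
        show "norm ((exp_recip n (0 + h) - exp_recip n 0) / h) \<le> fact (n + 2) * \<bar>h\<bar>" for h
          using exp_recip_bound[of n h] exp_recip_bound[of n 0]
          by (cases "h = 0") (auto simp: divide_le_eq power2_eq_square abs_mult_self_eq mult.assoc)
      qed
      show "((\<lambda>h::real. fact (n + 2) * \<bar>h\<bar>) \<longlongrightarrow> 0) (at 0)"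
        by (auto intro!: tendsto_eq_intros)
    qed
    then show ?thesis unfolding 2 by (simp add: DERIV_def exp_recip_def)
  next
    case 3
    have "((\<lambda>t. exp (- (1 / t)) / t ^ n) has_real_derivative
        (exp_recip (n + 2) t - real n * exp_recip (n + 1) t)) (at t)"
      using 3
      by (cases n) (auto intro!: derivative_eq_intros
         simp: exp_recip_def field_simps power2_eq_square, metis One_nat_def power_eq_if)
    then show ?thesis
      by (rule has_field_derivative_transform_within_open[where S = "{0<..}"])
         (use 3 in \<open>auto simp: exp_recip_def\<close>)
  qed
qed

lemma Ck_on_exp_recip: "Ck_on k UNIV (exp_recip n)"
proof (induction k arbitrary: n)
  case 0
  then show ?case
    using DERIV_isCont[OF exp_recip_has_derivative] by (auto simp: continuous_on_eq_continuous_at)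
next
  case (Suc k)
  show ?case
  proof (rule Ck_on_SucI)
    show "(exp_recip n has_derivative (*) (exp_recip (n + 2) x - real n * exp_recip (n + 1) x)) (at x)"
      for x
      using exp_recip_has_derivative by (simp add: has_field_derivative_def)
    have "Ck_on k UNIV (\<lambda>x. v *\<^sub>R exp_recip (n + 2) x + (- v * real n) *\<^sub>R exp_recip (n + 1) x)"
      for v
      by (intro Ck_on_add Ck_on_linear_comp[OF bounded_linear_scaleR_right] Suc) auto
    then show "Ck_on k UNIV (\<lambda>x. (exp_recip (n + 2) x - real n * exp_recip (n + 1) x) * v)" for v
      by (simp add: algebra_simps)
  qed auto
qed

text \<open>The flat function is applied to \<open>r\<^sup>2 - (x - a) \<bullet> (x - a)\<close>, a polynomial in \<open>x\<close>,
  whereas \<open>norm (x - a)\<close> would not be differentiable at the centre.\<close>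

lemma bump_function_exists:
  fixes a :: "'a::euclidean_space"
  assumes "r > 0"
  obtains \<beta> :: "'a \<Rightarrow> real"
  where "\<And>k. Ck_on k UNIV \<beta>" "\<beta> a \<noteq> 0" "\<And>x. x \<notin> cball a r \<Longrightarrow> \<beta> x = 0"
proof
  define \<rho> where "\<rho> x = r\<^sup>2 + (-1) *\<^sub>R ((x - a) \<bullet> (x - a))" for x :: 'a
  let ?\<beta> = "\<lambda>x. exp_recip 0 (\<rho> x)"
  have "Ck_on k UNIV (\<lambda>x. x + (- a))" for k
    by (intro Ck_on_add Ck_on_const Ck_on_bounded_linear bounded_linear_ident) auto
  then have "Ck_on k UNIV \<rho>" for k
    unfolding \<rho>_def
    by (intro Ck_on_add Ck_on_const Ck_on_linear_comp[OF bounded_linear_scaleR_right]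
        Ck_on_bilinear[OF bounded_bilinear_inner]) auto
  then show "Ck_on k UNIV ?\<beta>" for k
    by (rule Ck_on_compose[OF open_UNIV open_UNIV subset_UNIV _ Ck_on_exp_recip])
  show "?\<beta> a \<noteq> 0" using assms by (simp add: \<rho>_def exp_recip_def)
  show "?\<beta> x = 0" if "x \<notin> cball a r" for x
  proof -
    have "r < norm (x - a)" using that by (simp add: dist_norm norm_minus_commute)
    then have "r\<^sup>2 \<le> (norm (x - a))\<^sup>2" using assms by (intro power_mono) auto
    then show ?thesis by (simp add: \<rho>_def exp_recip_def power2_norm_eq_inner)
  qed
qed

section \<open>Charts and tangent spaces\<close>

context
  fixes M :: "'m topology" and A :: "('m, 'e::euclidean_space) chart set"
  assumes manifold: "smooth_manifold M A"
begin

lemma chart_facts: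
  assumes "c \<in> A"
  shows openin_chart: "openin M (fst c)"
    and open_chart_image: "open (snd c ` fst c)"
    and chart_homeomorphic:
      "homeomorphic_map (subtopology M (fst c)) (top_of_set (snd c ` fst c)) (snd c)"
    and chart_topspace: "topspace (subtopology M (fst c)) = fst c"
  using manifold assms unfolding smooth_manifold_def
  by (auto simp: case_prod_unfold dest: openin_subset)

lemma inj_on_chart: "c \<in> A \<Longrightarrow> inj_on (snd c) (fst c)"
  using homeomorphic_imp_injective_map[OF chart_homeomorphic] chart_topspace by metis

lemma chart_inv_chart: "c \<in> A \<Longrightarrow> q \<in> fst c \<Longrightarrow> chart_inv c (snd c q) = q"
  unfolding chart_inv_def by (simp add: inj_on_chart)

lemma open_image_chart:
  assumes c: "c \<in> A" and V: "openin M V" "V \<subseteq> fst c"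
  shows "open (snd c ` V)"
proof -
  have "openin (subtopology M (fst c)) V"
    using V by (metis openin_chart[OF c] openin_open_subtopology)
  then have "openin (top_of_set (snd c ` fst c)) (snd c ` V)"
    using homeomorphic_imp_open_map[OF chart_homeomorphic[OF c]] by (simp add: open_map_def)
  then show ?thesis using open_chart_image[OF c] openin_open_trans by blast
qed

lemma open_overlap: "c \<in> A \<Longrightarrow> d \<in> A \<Longrightarrow> open (snd c ` (fst c \<inter> fst d))"
  by (rule open_image_chart) (auto intro: openin_chart)

lemma transition_chart: "c \<in> A \<Longrightarrow> q \<in> fst c \<Longrightarrow> transition c d (snd c q) = snd d q"
  by (simp add: transition_def chart_inv_chart)

lemma Ck_on_transition: "c \<in> A \<Longrightarrow> d \<in> A \<Longrightarrow> Ck_on k (snd c ` (fst c \<inter> fst d)) (transition c d)"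
  using manifold unfolding smooth_manifold_def smooth_on_def by blast

lemma transition_has_derivative:
  assumes "c \<in> A" "d \<in> A" "q \<in> fst c" "q \<in> fst d"
  shows "(transition c d has_derivative frechet_derivative (transition c d) (at (snd c q)))
           (at (snd c q))"
  by (rule Ck_on_SucD[OF Ck_on_transition]) (use assms in auto)

text \<open>The chain rule for \<open>transition d d' \<circ> transition c d = transition c d'\<close>, which holds only
  on the triple overlap; that set is open, so it determines the derivative.\<close>

lemma transition_derivative_cocycle:
  assumes "c \<in> A" "d \<in> A" "d' \<in> A" "q \<in> fst c" "q \<in> fst d" "q \<in> fst d'"
  shows "frechet_derivative (transition d d') (at (snd d q))
           (frechet_derivative (transition c d) (at (snd c q)) e) =
         frechet_derivative (transition c d') (at (snd c q)) e"
proof -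
  let ?F = "\<lambda>v. frechet_derivative (transition d d') (at (snd d q))
              (frechet_derivative (transition c d) (at (snd c q)) v)"
  let ?S = "snd c ` (fst c \<inter> fst d \<inter> fst d')"
  have "((\<lambda>x. transition d d' (transition c d x)) has_derivative ?F) (at (snd c q))"
    using has_derivative_compose[OF transition_has_derivative[of c d q]]
      transition_has_derivative[of d d' q] assms by (simp add: transition_chart)
  moreover have "open ?S"
    by (rule open_image_chart[OF assms(1)]) (use assms in \<open>auto intro!: openin_Int openin_chart\<close>)
  ultimately have "(transition c d' has_derivative ?F) (at (snd c q))"
    by (rule has_derivative_transform_within_open)
       (use assms in \<open>auto simp: transition_chart\<close>)
  then show ?thesis by (metis frechet_derivative_at)
qed

lemma linear_transition_derivative:
  assumes "c \<in> charts_at A q" "d \<in> charts_at A q"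
  shows "linear (frechet_derivative (transition c d) (at (snd c q)))"
  by (rule has_derivative_linear[OF transition_has_derivative])
     (use assms in \<open>auto simp: charts_at_def\<close>)

text \<open>The defining equations of a tangent vector express each coordinate vector by every other one and
  loop as rewrite rules. They are used through the following instances.\<close>

lemma tangent_space_transform:
  assumes "v \<in> tangent_space A q" "c \<in> charts_at A q" "d \<in> charts_at A q"
  shows "v d = frechet_derivative (transition c d) (at (snd c q)) (v c)"
  using assms unfolding tangent_space_def by blast

lemma tangent_space_default: "v \<in> tangent_space A q \<Longrightarrow> c \<notin> charts_at A q \<Longrightarrow> v c = 0"
  unfolding tangent_space_def by blast

lemma tangent_spaceI:
  assumes "\<And>c. c \<notin> charts_at A q \<Longrightarrow> v c = 0"
    "\<And>c d. c \<in> charts_at A q \<Longrightarrow> d \<in> charts_at A q \<Longrightarrow>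
       v d = frechet_derivative (transition c d) (at (snd c q)) (v c)"
  shows "v \<in> tangent_space A q"
  using assms unfolding tangent_space_def by blast

lemma tangent_space_zero: "0 \<in> tangent_space A q"
  by (rule tangent_spaceI) (simp_all add: linear_0[OF linear_transition_derivative])

lemma tangent_space_scale:
  assumes "v \<in> tangent_space A q"
  shows "a *\<^sub>R v \<in> tangent_space A q"
proof (rule tangent_spaceI)
  fix c d assume c: "c \<in> charts_at A q" and d: "d \<in> charts_at A q"
  show "(a *\<^sub>R v) d = frechet_derivative (transition c d) (at (snd c q)) ((a *\<^sub>R v) c)"
    by (simp add: linear_scale[OF linear_transition_derivative[OF c d]]
        flip: tangent_space_transform[OF assms c d])
qed (simp add: tangent_space_default[OF assms])

lemma tangent_space_add:
  assumes u: "u \<in> tangent_space A q" and v: "v \<in> tangent_space A q"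
  shows "u + v \<in> tangent_space A q"
proof (rule tangent_spaceI)
  fix c d assume c: "c \<in> charts_at A q" and d: "d \<in> charts_at A q"
  show "(u + v) d = frechet_derivative (transition c d) (at (snd c q)) ((u + v) c)"
    by (simp add: linear_add[OF linear_transition_derivative[OF c d]]
        flip: tangent_space_transform[OF u c d] tangent_space_transform[OF v c d])
qed (simp add: tangent_space_default[OF u] tangent_space_default[OF v])

lemma tangent_space_diff:
  "u \<in> tangent_space A q \<Longrightarrow> v \<in> tangent_space A q \<Longrightarrow> u - v \<in> tangent_space A q"
  using tangent_space_add[of u q "- 1 *\<^sub>R v"] tangent_space_scale[of v q "- 1"] by simp

lemma coord_vector_tangent: "c \<in> charts_at A q \<Longrightarrow> coord_vector A c q e \<in> tangent_space A q"
  by (rule tangent_spaceI)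
     (auto simp: coord_vector_def charts_at_def transition_derivative_cocycle)

lemma tangent_eq_coord_vector:
  assumes "v \<in> tangent_space A q" "c \<in> charts_at A q"
  shows "v = coord_vector A c q (v c)"
proof
  show "v d = coord_vector A c q (v c) d" for d
    using tangent_space_transform[OF assms, of d] tangent_space_default[OF assms(1), of d]
    by (cases "d \<in> charts_at A q") (auto simp only: coord_vector_def if_True if_False)
qed

lemma linear_coord_vector:
  assumes "c \<in> charts_at A q"
  shows "linear (coord_vector A c q)"
  using linear_transition_derivative[OF assms]
  by (intro linearI) (auto simp: coord_vector_def fun_eq_iff linear_add linear_scale)

lemma charts_cover: "(\<Union>c\<in>A. fst c) = topspace M"
  using manifold by (simp add: smooth_manifold_def)

lemma charts_at_nonempty: "q \<in> topspace M \<Longrightarrow> \<exists>c. c \<in> charts_at A q"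
  unfolding charts_cover[symmetric] charts_at_def by blast

lemma tangent_space_outside:
  assumes "q \<notin> topspace M" "v \<in> tangent_space A q"
  shows "v = 0"
proof -
  have "charts_at A q = {}"
    using assms(1) unfolding charts_cover[symmetric] charts_at_def by blast
  then show ?thesis using tangent_space_default[OF assms(2)] by (simp add: fun_eq_iff)
qed

section \<open>Smooth vector fields\<close>

text \<open>In a chart, \<open>K\<close> acts on a field as a matrix whose columns are its values on the coordinate
  fields, which are smooth by definition of a tensor field.\<close>

lemma endo_apply_vector_field:
  assumes K: "tensor_field11 A K" and X: "X \<in> vector_fields A"
  shows "endo_apply K X \<in> vector_fields A"
proof -
  have tan: "X q \<in> tangent_space A q" for q using X by (simp add: vector_fields_def)
  have "Ck_on k (snd c ` fst c) (\<lambda>x. endo_apply K X (chart_inv c x) c)" if c: "c \<in> A" for c k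
  proof (rule Ck_on_cong[OF open_chart_image[OF c]])
    let ?V = "\<lambda>x b. coord_vector A c (chart_inv c x) b"
    let ?f = "\<lambda>x. \<Sum>b\<in>Basis. (X (chart_inv c x) c \<bullet> b) *\<^sub>R K (chart_inv c x) (?V x b) c"
    show "?f x = endo_apply K X (chart_inv c x) c" if "x \<in> snd c ` fst c" for x
    proof -
      let ?q = "chart_inv c x"
      have q: "c \<in> charts_at A ?q"
        using that c by (auto simp: charts_at_def chart_inv_chart)
      have "linear (\<lambda>e. K ?q (?V x e) c)"
        using K coord_vector_tangent[OF q] linear_coord_vector[OF q]
        by (intro linearI) (auto simp: tensor_field11_def linear_add linear_scale)
      from linear_expand_Basis[OF this, of "X ?q c"]
      show ?thesis
        by (simp add: endo_apply_def flip: tangent_eq_coord_vector[OF tan q])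
    qed
    show "Ck_on k (snd c ` fst c) ?f"
    proof (intro Ck_on_sum Ck_on_bilinear[OF bounded_bilinear_scaleR]
        Ck_on_linear_comp[OF bounded_linear_inner_left] open_chart_image[OF c])
      show "Ck_on k (snd c ` fst c) (\<lambda>x. X (chart_inv c x) c)"
        using X c by (auto simp: vector_fields_def smooth_on_def)
      show "Ck_on k (snd c ` fst c) (\<lambda>x. K (chart_inv c x) (?V x b) c)" for b
        using K c by (auto simp: tensor_field11_def smooth_on_def)
    qed
  qed
  moreover have "endo_apply K X q \<in> tangent_space A q" for q
    using K tan by (auto simp: tensor_field11_def endo_apply_def)
  ultimately show ?thesis by (simp add: vector_fields_def smooth_on_def)
qed

text \<open>The coordinate field of \<open>c\<close> through \<open>v\<close>, cut off by a bump function that vanishes off a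
  closed ball in the image of \<open>c\<close>, is extended by zero. The preimage \<open>K\<close> of the ball is
  compact, hence closed in the Hausdorff space \<open>M\<close>. So in any other chart \<open>d\<close> the
  field is smooth on two open sets that cover the domain: the overlap with \<open>c\<close>, where it is given
  by the differential of the transition map, and the complement of \<open>K\<close>, where it is zero.\<close>

lemma cutoff_field_extends_tangent:
  assumes c: "c \<in> charts_at A p" and v: "v \<in> tangent_space A p"
  obtains Z a where "Z \<in> vector_fields A" "a \<noteq> 0" "Z p = a *\<^sub>R v"
proof -
  have cA: "c \<in> A" and pc: "p \<in> fst c" using c by (auto simp: charts_at_def)
  obtain r where r: "r > 0" "cball (snd c p) r \<subseteq> snd c ` fst c"
    using open_chart_image[OF cA] pc open_contains_cball by blast
  obtain \<beta> :: "'e \<Rightarrow> real" where \<beta>: "\<And>k. Ck_on k UNIV \<beta>" "\<beta> (snd c p) \<noteq> 0"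
    "\<And>x. x \<notin> cball (snd c p) r \<Longrightarrow> \<beta> x = 0"
    using bump_function_exists[OF r(1)] by metis
  define Z :: "('m, 'e) field"
    where "Z q = (if q \<in> fst c then \<beta> (snd c q) *\<^sub>R coord_vector A c q (v c) else 0)" for q
  define K where "K = {q \<in> fst c. snd c q \<in> cball (snd c p) r}"
  have "snd c ` K = cball (snd c p) r" using r(2) by (auto simp: K_def)
  then have "compactin (top_of_set (snd c ` fst c)) (snd c ` K)"
    using r(2) by (simp add: compactin_subtopology)
  then have "compactin (subtopology M (fst c)) K"
    using homeomorphic_map_compactness[OF chart_homeomorphic[OF cA], of K] chart_topspace[OF cA]
    by (auto simp: K_def)
  then have closed_K: "closedin M K"
    using manifold by (simp add: smooth_manifold_def compactin_subtopology compactin_imp_closedin)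
  have Z0: "Z q = 0" if "q \<notin> K" for q using that \<beta>(3) by (auto simp: Z_def K_def)
  have "Ck_on k (snd d ` fst d) (\<lambda>x. Z (chart_inv d x) d)" if d: "d \<in> A" for d k
  proof -
    let ?S = "snd d ` (fst d \<inter> fst c)" and ?T = "snd d ` (fst d - K)"
    let ?R = "snd c ` (fst c \<inter> fst d)"
    have oS: "open ?S" and oR: "open ?R" using open_overlap d cA by auto
    have oT: "open ?T"
      by (rule open_image_chart[OF d]) (use openin_chart[OF d] closed_K in auto)
    have im: "transition d c ` ?S \<subseteq> ?R"
      using d by (auto simp: transition_chart)
    have "Ck_on k ?S (\<lambda>x. Z (chart_inv d x) d)"
    proof (rule Ck_on_cong[OF oS])
      let ?f = "\<lambda>x. \<beta> (transition d c x) *\<^sub>R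
                 frechet_derivative (transition c d) (at (transition d c x)) (v c)"
      show "?f x = Z (chart_inv d x) d" if "x \<in> ?S" for x
        using that d cA
        by (auto simp: Z_def chart_inv_chart transition_chart coord_vector_def charts_at_def)
      have "Ck_on k ?R (\<lambda>y. frechet_derivative (transition c d) (at y) (v c))"
        using Ck_on_transition[OF cA d, of "Suc k"] by simp
      then show "Ck_on k ?S ?f"
        using Ck_on_compose[OF oS _ _ Ck_on_transition[OF d cA] \<beta>(1)]
          Ck_on_compose[OF oS oR im Ck_on_transition[OF d cA]]
        by (intro Ck_on_bilinear[OF bounded_bilinear_scaleR oS]) auto
    qed
    moreover have "Ck_on k ?T (\<lambda>x. Z (chart_inv d x) d)"
      by (rule Ck_on_cong[OF oT _ Ck_on_const[OF oT, of _ 0]])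
         (use d in \<open>auto simp: chart_inv_chart Z0\<close>)
    moreover have "snd d ` fst d = ?S \<union> ?T" by (auto simp: K_def)
    ultimately show ?thesis using Ck_on_Un[OF oS oT] by metis
  qed
  moreover have "Z q \<in> tangent_space A q" for q
  proof (cases "q \<in> fst c")
    case True
    then show ?thesis
      using cA by (auto simp: Z_def charts_at_def intro!: tangent_space_scale coord_vector_tangent)
  qed (simp add: Z_def tangent_space_zero)
  ultimately have "Z \<in> vector_fields A" by (simp add: vector_fields_def smooth_on_def)
  moreover have "Z p = \<beta> (snd c p) *\<^sub>R v"
    using pc by (simp add: Z_def flip: tangent_eq_coord_vector[OF v c])
  ultimately show thesis using that \<beta>(2) by blast
qed

end

section \<open>Conjugate connections and adjoint tensor fields\<close>

lemma connection_field:
  assumes "linear_connection A D" "X \<in> vector_fields A" "Y \<in> vector_fields A"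
  shows "D X Y \<in> vector_fields A"
  using assms(1)[unfolded linear_connection_def, THEN bspec, OF assms(2), THEN bspec, OF assms(3)]
  by (rule conjunct1)

lemma conjugate_connection_linear: "conjugate_connection M A g D Ds \<Longrightarrow> linear_connection A Ds"
  unfolding conjugate_connection_def by (rule conjunct1)

lemma conjugate_connection_product_rule:
  assumes "conjugate_connection M A g D Ds" "p \<in> topspace M"
    "X \<in> vector_fields A" "Y \<in> vector_fields A" "Z \<in> vector_fields A"
  shows "field_deriv A Z (form_apply g X Y) p =
         form_apply g (D Z X) Y p + form_apply g X (Ds Z Y) p"
  by (rule assms(1)[unfolded conjugate_connection_def, THEN conjunct2, THEN bspec, THEN bspec,
        THEN bspec, THEN bspec, OF assms(3-5,2)])

text \<open>A tensor field with its adjoint, separated from the connections so that the results apply both to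
  \<open>(D, D\<^sup>*)\<close> and to \<open>(D\<^sup>*, D)\<close>.\<close>

locale adjoint_pair =
  fixes M :: "'m topology"
    and A :: "('m, 'e::euclidean_space) chart set"
    and J Js :: "('m, 'e) endo"
    and g :: "('m, 'e) form2"
  assumes manifold: "smooth_manifold M A"
    and metric: "pseudo_Riemannian_metric A g"
    and tensors: "tensor_field11 A J" "tensor_field11 A Js"
    and adjoint: "\<And>X Y. X \<in> vector_fields A \<Longrightarrow> Y \<in> vector_fields A \<Longrightarrow>
        form_apply g (endo_apply J X) Y = form_apply g X (endo_apply Js Y)"
begin

lemma field_tangent: "X \<in> vector_fields A \<Longrightarrow> X p \<in> tangent_space A p"
  by (simp add: vector_fields_def)

lemmas metric_linear =
  metric[unfolded pseudo_Riemannian_metric_def, THEN conjunct1, THEN spec, THEN bspec, THEN bspec]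

lemma metric_sym:
  assumes "u \<in> tangent_space A p" "v \<in> tangent_space A p"
  shows "g p u v = g p v u"
  using metric_linear[OF assms] by (rule conjunct1)

lemma metric_scale:
  assumes "u \<in> tangent_space A p" "v \<in> tangent_space A p"
  shows "g p (a *\<^sub>R u) v = a * g p u v"
  using metric_linear[OF assms, THEN conjunct2, THEN conjunct1] by (rule spec)

lemma metric_diff:
  assumes "u \<in> tangent_space A p" "v \<in> tangent_space A p" "w \<in> tangent_space A p"
  shows "g p (u - w) v = g p u v - g p w v"
proof -
  have "g p ((u - w) + w) v = g p (u - w) v + g p w v"
    using metric_linear[OF tangent_space_diff[OF manifold assms(1,3)] assms(2),
        THEN conjunct2, THEN conjunct2] assms(3) by (rule bspec)
  then show ?thesis by simp
qed

lemma form_sym: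
  "X \<in> vector_fields A \<Longrightarrow> Y \<in> vector_fields A \<Longrightarrow> form_apply g X Y = form_apply g Y X"
  unfolding form_apply_def by (intro ext metric_sym field_tangent)

lemmas endo_field = endo_apply_vector_field[OF manifold tensors(1)]
  endo_apply_vector_field[OF manifold tensors(2)]

lemma cov_deriv_tangent:
  assumes "linear_connection A D" "tensor_field11 A K" "X \<in> vector_fields A" "Y \<in> vector_fields A"
  shows "cov_deriv D K X Y p \<in> tangent_space A p"
proof -
  have "D X (endo_apply K Y) p - endo_apply K (D X Y) p \<in> tangent_space A p"
    by (intro tangent_space_diff[OF manifold] field_tangent connection_field[OF assms(1)]
        endo_apply_vector_field[OF manifold assms(2)] assms)
  then show ?thesis by (simp add: cov_deriv_def)
qed

lemma form_cov_deriv: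
  assumes "linear_connection A D" "tensor_field11 A K"
    "X \<in> vector_fields A" "Y \<in> vector_fields A" "Z \<in> vector_fields A"
  shows "g p (cov_deriv D K X Y p) (Z p) =
         form_apply g (D X (endo_apply K Y)) Z p - form_apply g (endo_apply K (D X Y)) Z p"
proof -
  have "D X (endo_apply K Y) p \<in> tangent_space A p" "endo_apply K (D X Y) p \<in> tangent_space A p"
    by (intro field_tangent connection_field[OF assms(1)]
        endo_apply_vector_field[OF manifold assms(2)] assms)+
  then show ?thesis
    by (simp add: cov_deriv_def form_apply_def metric_diff field_tangent[OF assms(5)])
qed

text \<open>Pairing with global fields suffices to detect a tangent vector, because their values at \<open>p\<close>
  exhaust the tangent space up to nonzero factors.\<close>

lemma metric_nondegenerate_on_fields:
  assumes u: "u \<in> tangent_space A p" and p: "p \<in> topspace M"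
    and zero: "\<And>Z. Z \<in> vector_fields A \<Longrightarrow> g p u (Z p) = 0"
  shows "u = 0"
proof -
  obtain c where c: "c \<in> charts_at A p" using charts_at_nonempty[OF manifold p] by blast
  have "g p u v = 0" if v: "v \<in> tangent_space A p" for v
  proof -
    obtain Z a where Z: "Z \<in> vector_fields A" "a \<noteq> 0" "Z p = a *\<^sub>R v"
      using cutoff_field_extends_tangent[OF manifold c v] by metis
    have "a * g p v u = g p u (Z p)"
      using Z metric_scale[OF v u] metric_sym[OF u] tangent_space_scale[OF manifold v] by metis
    then show ?thesis using zero[OF Z(1)] Z(2) metric_sym[OF u v] by simp
  qed
  then show ?thesis
    using metric[unfolded pseudo_Riemannian_metric_def, THEN conjunct2, THEN conjunct1] u by blast
qed

text \<open>Both sides are differences of the terms in the two product-rule expansions of the derivative of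
  \<open>g(J\<^sup>*Y, Z) = g(Y, JZ)\<close> along \<open>X\<close>.\<close>

lemma adjoint_cov_deriv:
  assumes lin: "linear_connection A D" and conj: "conjugate_connection M A g D Ds"
    and X: "X \<in> vector_fields A" and Y: "Y \<in> vector_fields A" and Z: "Z \<in> vector_fields A"
    and p: "p \<in> topspace M"
  shows "g p (cov_deriv D Js X Y p) (Z p) = g p (cov_deriv Ds J X Z p) (Y p)"
proof -
  note lin' = conjugate_connection_linear[OF conj]
  have DXY: "D X Y \<in> vector_fields A" by (rule connection_field[OF lin X Y])
  have DsXZ: "Ds X Z \<in> vector_fields A" by (rule connection_field[OF lin' X Z])
  have DsXJZ: "Ds X (endo_apply J Z) \<in> vector_fields A"
    by (rule connection_field[OF lin' X endo_field(1)[OF Z]])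
  have prod_rule: "field_deriv A X (form_apply g U V) p =
      form_apply g (D X U) V p + form_apply g U (Ds X V) p"
    if "U \<in> vector_fields A" "V \<in> vector_fields A" for U V
    by (rule conjugate_connection_product_rule[OF conj p that X])
  have swap: "form_apply g (endo_apply Js U) V = form_apply g U (endo_apply J V)"
    if "U \<in> vector_fields A" "V \<in> vector_fields A" for U V
    using adjoint[OF that(2,1)] form_sym[OF endo_field(2)[OF that(1)] that(2)]
      form_sym[OF endo_field(1)[OF that(2)] that(1)] by simp
  have "form_apply g (D X (endo_apply Js Y)) Z p + form_apply g (endo_apply Js Y) (Ds X Z) p
      = form_apply g (D X Y) (endo_apply J Z) p + form_apply g Y (Ds X (endo_apply J Z)) p"
    using prod_rule[OF endo_field(2)[OF Y] Z] prod_rule[OF Y endo_field(1)[OF Z]] swap[OF Y Z]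
    by simp
  then show ?thesis
    unfolding form_cov_deriv[OF lin tensors(2) X Y Z] form_cov_deriv[OF lin' tensors(1) X Z Y]
    unfolding form_sym[OF DsXJZ Y] form_sym[OF endo_field(1)[OF DsXZ] Y]
      swap[OF DXY Z] swap[OF Y DsXZ] by simp
qed

lemma conjugate_connection_sym:
  assumes "linear_connection A D" "conjugate_connection M A g D Ds"
  shows "conjugate_connection M A g Ds D"
proof -
  note lin' = conjugate_connection_linear[OF assms(2)]
  have "field_deriv A Z (form_apply g X Y) p =
      form_apply g (Ds Z X) Y p + form_apply g X (D Z Y) p"
    if XYZ: "X \<in> vector_fields A" "Y \<in> vector_fields A" "Z \<in> vector_fields A"
      and p: "p \<in> topspace M" for X Y Z p
  proof -
    have "Ds Z X \<in> vector_fields A" "D Z Y \<in> vector_fields A"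
      using connection_field[OF lin'] connection_field[OF assms(1)] XYZ by auto
    moreover have "field_deriv A Z (form_apply g Y X) p =
      form_apply g (D Z Y) X p + form_apply g Y (Ds Z X) p"
      by (rule conjugate_connection_product_rule[OF assms(2) p XYZ(2,1,3)])
    ultimately show ?thesis using form_sym XYZ by (simp add: add.commute)
  qed
  with assms(1) show ?thesis
    unfolding conjugate_connection_def by (intro conjI ballI)
qed

text \<open>The adjoint relation exchanges the last two of the arguments \<open>X, Y, Z\<close> and turns \<open>T\<close>
  into \<open>S\<close> or back, whereas the Codazzi conditions exchange the first two. The product of these
  two transpositions is a 3-cycle, so after three uses of each the arguments are back in order, while the
  odd number of uses of the adjoint relation has turned \<open>T\<close> into \<open>S\<close>.\<close>

lemma Codazzi_imp_cov_deriv_eq: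
  assumes lin: "linear_connection A D" and conj: "conjugate_connection M A g D Ds"
    and cod: "Codazzi_coupled A D Js" "Codazzi_coupled A Ds J"
  shows "cov_deriv_eq A D Js Ds J"
  unfolding cov_deriv_eq_def
proof (intro ballI ext)
  fix X Y p assume X: "X \<in> vector_fields A" and Y: "Y \<in> vector_fields A"
  let ?T = "cov_deriv D Js" and ?S = "cov_deriv Ds J"
  note lin' = conjugate_connection_linear[OF conj]
  have tan: "?T X Y p \<in> tangent_space A p" "?S X Y p \<in> tangent_space A p"
    using cov_deriv_tangent X Y lin lin' tensors by auto
  have "?T X Y p - ?S X Y p = 0"
  proof (cases "p \<in> topspace M")
    \<comment> \<open>The product rule says nothing here, but the tangent space is \<open>{0}\<close>.\<close>
    case False
    then show ?thesis
      using tangent_space_outside[OF manifold] tangent_space_diff[OF manifold] tan by metis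
  next
    case True
    note adj = adjoint_cov_deriv[OF lin conj _ _ _ True]
    have sym: "?T U V = ?T V U" "?S U V = ?S V U"
      if "U \<in> vector_fields A" "V \<in> vector_fields A" for U V
      using cod that unfolding Codazzi_coupled_def by blast+
    show ?thesis
    proof (rule metric_nondegenerate_on_fields[OF tangent_space_diff[OF manifold tan] True])
      fix Z assume Z: "Z \<in> vector_fields A"
      have "g p (?T X Y p) (Z p) = g p (?S X Z p) (Y p)" by (rule adj[OF X Y Z])
      also have "\<dots> = g p (?S Z X p) (Y p)" by (simp only: sym(2)[OF X Z])
      also have "\<dots> = g p (?T Z Y p) (X p)" by (rule adj[OF Z Y X, symmetric])
      also have "\<dots> = g p (?T Y Z p) (X p)" by (simp only: sym(1)[OF Z Y])
      also have "\<dots> = g p (?S Y X p) (Z p)" by (rule adj[OF Y Z X])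
      also have "\<dots> = g p (?S X Y p) (Z p)" by (simp only: sym(2)[OF X Y])
      finally show "g p (?T X Y p - ?S X Y p) (Z p) = 0"
        using metric_diff[OF tan(1) field_tangent[OF Z] tan(2)] by simp
    qed
  qed
  then show "?T X Y p c = ?S X Y p c" for c by simp
qed

end

theorem proposition23:
  fixes M :: "'m topology"
    and A :: "('m, 'e::euclidean_space) chart set"
    and J Js :: "('m, 'e) endo"
    and g :: "('m, 'e) form2"
    and D Ds :: "('m, 'e) connection"
  assumes "metallic_like_pseudo_Riemannian M A J g Js"
    and "linear_connection A D"
    and "conjugate_connection M A g D Ds"
  shows "(Codazzi_coupled A D Js \<and> Codazzi_coupled A Ds J \<longrightarrow> cov_deriv_eq A D Js Ds J) \<and>
         (Codazzi_coupled A Ds Js \<and> Codazzi_coupled A D J \<longrightarrow> cov_deriv_eq A Ds Js D J)"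
proof -
  interpret adjoint_pair M A J Js g
    using assms(1)
    by unfold_locales (auto simp: metallic_like_pseudo_Riemannian_def metallic_structure_def)
  have "linear_connection A Ds" by (rule conjugate_connection_linear[OF assms(3)])
  then show ?thesis
    using Codazzi_imp_cov_deriv_eq assms(2,3) conjugate_connection_sym by blast
qed

end
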